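(* Let $\lambda>0$ be fixed, let $\rho^{\bm u}_{\mathrm{opt}}:[t_0,t_1]\times\mathbb{R}^n\to(0,\infty)$ and $S:[t_0,t_1]\times\mathbb{R}^n\to\mathbb{R}$ be as in the context, and define $$R:=\tfrac12\log\rho^{\bm u}_{\mathrm{opt}},\qquad \psi:=\exp\left(R+\tfrac{\mathrm{i}}{\lambda}S\right),\qquad \psi^{\dagger}:=\exp\left(R-\tfrac{\mathrm{i}}{\lambda}S\right).$$ Then the system for $(\rho^{\bm u}_{\mathrm{opt}},S)$ given by $$\partial_t\rho^{\bm u}_{\mathrm{opt}}+\nabla_{\bm x}\cdot\left(\rho^{\bm u}_{\mathrm{opt}}\left(\bm f+\bm g\bm g^{\top}\nabla_{\bm x}S\right)\right)=\tfrac12\Delta_{\bm\Sigma}\rho^{\bm u}_{\mathrm{opt}},$$ $$\partial_tS+\langle\nabla_{\bm x}S,\bm f\rangle+\tfrac12\langle\nabla_{\bm x}S,\bm g\bm g^{\top}\nabla_{\bm x}S\rangle+\tfrac12\langle\bm\Sigma,\mathrm{Hess}_{\bm x}S\rangle=q,$$ $$\rho^{\bm u}_{\mathrm{opt}}(t_0,\cdot)=\rho_0(\cdot),\qquad \rho^{\bm u}_{\mathrm{opt}}(t_1,\cdot)=\rho_1(\cdot),$$ is equivalent to the boundary value problem for $\psi$ given by $$\mathrm{i}\lambda\,\partial_t\psi=-\tfrac{\lambda^2}{2}\Delta_{\bm\Sigma}\psi+V\psi,$$ $$\psi(t_0,\bm x)\psi^{\dagger}(t_0,\bm x)=\rho_0(\bm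 x),\qquad \psi(t_1,\bm x)\psi^{\dagger}(t_1,\bm x)=\rho_1(\bm x),$$ where the complex-valued potential $V$ (which depends on $\psi$ through $R$ and $S$) has real and imaginary parts $$\begin{aligned}\Re(V)=\;&\tfrac{\lambda^2}{2}\langle\mathrm{Hess}_{\bm x},\bm\Sigma\rangle+\tfrac{\lambda^2}{2}\langle\bm\Sigma,\mathrm{Hess}_{\bm x}R\rangle+\langle\nabla_{\bm x}S,\bm f\rangle+\tfrac{\lambda^2}{2}\|\nabla_{\bm x}R\|_{\bm\Sigma}^2-\tfrac12\|\nabla_{\bm x}S\|_{\bm\Sigma}^2\\&+\lambda^2\langle\nabla_{\bm x}\cdot\bm\Sigma,\nabla_{\bm x}R\rangle+\tfrac12\langle\nabla_{\bm x}S,\bm g\bm g^{\top}\nabla_{\bm x}S\rangle+\tfrac12\langle\bm\Sigma,\mathrm{Hess}_{\bm x}S\rangle-q,\end{aligned}$$ $$\begin{aligned}\Im(V)=\lambda\Big\{&\tfrac12\langle\bm\Sigma,\mathrm{Hess}_{\bm x}S\rangle+(\nabla_{\bm x}R)^{\top}\bm\Sigma(\nabla_{\bm x}S)+\langle\nabla_{\bm x}\cdot\bm\Sigma,\nabla_{\bm x}S\rangle-\langle\nabla_{\bm x}R,\bm f+\bm g\bm g^{\top}\nabla_{\bm x}S\rangle\\&-\tfrac12\nabla_{\bm x}\cdot\left(\bm f+\bm g\bm g^{\top}\nabla_{\bm x}S\right)+\tfrac12\Delta_{\bm\Sigma}R+(\nabla_{\bm x}R)^{\top}\bm\Sigma\nabla_{\bm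 x}R+\left(\tfrac14-\tfrac12R\right)\langle\mathrm{Hess}_{\bm x},\bm\Sigma\rangle\Big\}.\end{aligned}$$ That is, $(\rho^{\bm u}_{\mathrm{opt}},S)$ satisfies the first system if and only if $\psi$ satisfies the boundary value problem with this $V$.
   Context: Setting. Fix a time horizon $[t_0,t_1]$, probability density functions $\rho_0,\rho_1$ on $\mathbb{R}^n$ with finite second moments, a bounded measurable $q:[t_0,t_1]\times\mathbb{R}^n\to\mathbb{R}$, and coefficients $\bm f:[t_0,t_1]\times\mathbb{R}^n\to\mathbb{R}^n$, $\bm g:[t_0,t_1]\times\mathbb{R}^n\to\mathbb{R}^{n\times m}$, $\bm\sigma:[t_0,t_1]\times\mathbb{R}^n\to\mathbb{R}^{n\times p}$. Put $\bm\Sigma:=\bm\sigma\bm\sigma^{\top}$ (an $n\times n$ symmetric matrix field). Standing assumptions: (A1) there are $c_1,c_2>0$ such that for all $\bm x,\bm y\in\mathbb{R}^n$ and $t\in[t_0,t_1]$, $\|\bm f(t,\bm x)\|_2+\|\bm\sigma(t,\bm x)\|_2\le c_1(1+\|\bm x\|_2)$ and $\|\bm f(t,\bm x)-\bm f(t,\bm y)\|_2\le c_2\|\bm x-\bm y\|_2$; (A2) there is $c_3>0$ such that for all $\bm x\in\mathbb{R}^n$ and $t\in[t_0,t_1]$, $\langle\bm x,\bm\Sigma(t,\bm x)\bm x\rangle\ge c_3\|\bm x\|_2^2$. The function $\rho^{\bm u}_{\mathrm{opt}}$ is real-valued, strictly positive, with each $\rho^{\bm u}_{\mathrm{opt}}(t,\cdot)$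 a probability density on $\mathbb{R}^n$; $S$ is real-valued, once continuously differentiable in $t$ and twice continuously differentiable in $\bm x$. All equations are understood in the classical (pointwise) sense, and $\rho^{\bm u}_{\mathrm{opt}}$, $\bm f,\bm g,\bm\Sigma$ are assumed differentiable to the order needed for the derivatives written to exist ($\rho^{\bm u}_{\mathrm{opt}}$ is $C^1$ in $t$ and $C^2$ in $\bm x$; $\bm\Sigma$ is $C^2$ in $\bm x$; $\bm f,\bm g$ are $C^1$ in $\bm x$). Notation. $\mathrm{i}=\sqrt{-1}$. $\nabla_{\bm x}$ is the Euclidean gradient, $\nabla_{\bm x}\cdot$ the divergence, $\mathrm{Hess}_{\bm x}$ the Hessian in $\bm x$. For a scalar (real or complex) function $h(t,\bm x)$, the weighted Laplacian is $\Delta_{\bm\Sigma}h:=\sum_{i,j=1}^n\partial^2_{x_ix_j}\left(\bm\Sigma_{ij}(t,\bm x)h(t,\bm x)\right)$. For matrices, $\langle A,B\rangle=\sum_{i,j}A_{ij}B_{ij}$; the symbol $\langle\mathrm{Hess}_{\bm x},\bm\Sigma\rangle$ means $\sum_{i,j=1}^n\partial^2_{x_ix_j}\bm\Sigma_{ij}$. The divergence of the matrix field is the vector field $(\nabla_{\bm x}\cdot\bm\Sigma)_i:=\sum_{j=1}^n\partial\bm\Sigma_{ij}/\partial x_j$. $\|\bm v\|_{\bm\Sigma}^2:=\bm v^{\top}\bm\Sigma\bm v$. *)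

theory Defs
  imports "HOL-Analysis.Analysis"
begin

definition C1_on_interval :: "real \<Rightarrow> real \<Rightarrow> (real \<Rightarrow> 'b::real_normed_vector) \<Rightarrow> bool" where
  "C1_on_interval a b h \<longleftrightarrow>
     (\<exists>D. (\<forall>t\<in>{a..b}. (h has_vector_derivative D t) (at t within {a..b})) \<and> continuous_on {a..b} D)"

definition C1_space :: "('a::real_normed_vector \<Rightarrow> 'b::real_normed_vector) \<Rightarrow> bool" where
  "C1_space h \<longleftrightarrow>
     (\<exists>D :: 'a \<Rightarrow> 'a \<Rightarrow>\<^sub>L 'b.
        (\<forall>x. (h has_derivative blinfun_apply (D x)) (at x)) \<and> continuous_on UNIV D)"

definition C2_space :: "('a::real_normed_vector \<Rightarrow> 'b::real_normed_vector) \<Rightarrow> bool" where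
  "C2_space h \<longleftrightarrow>
     (\<exists>D :: 'a \<Rightarrow> 'a \<Rightarrow>\<^sub>L 'b.
        (\<forall>x. (h has_derivative blinfun_apply (D x)) (at x)) \<and> C1_space D)"

(* With respect to n-dimensional Lebesgue measure. *)
definition prob_density :: "(real ^ 'n \<Rightarrow> real) \<Rightarrow> bool" where
  "prob_density r \<longleftrightarrow> (\<forall>x. 0 \<le> r x) \<and> has_bochner_integral lebesgue r 1"

definition finite_second_moment :: "(real ^ 'n \<Rightarrow> real) \<Rightarrow> bool" where
  "finite_second_moment r \<longleftrightarrow> integrable lebesgue (\<lambda>x. (norm x)\<^sup>2 * r x)"

(* vector_derivative rather than deriv, so that complex-valued functions of
   real coordinates are covered as well. *)
definition partial_deriv :: "'n \<Rightarrow> (real ^ 'n \<Rightarrow> 'b::real_normed_vector) \<Rightarrow> real ^ 'n \<Rightarrow> 'b" where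
  "partial_deriv i h x = vector_derivative (\<lambda>s. h (x + s *\<^sub>R axis i 1)) (at 0)"

definition gradient :: "(real ^ 'n \<Rightarrow> real) \<Rightarrow> real ^ 'n \<Rightarrow> real ^ 'n" where
  "gradient h x = (\<chi> i. partial_deriv i h x)"

definition hessian :: "(real ^ 'n \<Rightarrow> real) \<Rightarrow> real ^ 'n \<Rightarrow> real ^ 'n ^ 'n" where
  "hessian h x = (\<chi> i j. partial_deriv i (partial_deriv j h) x)"

definition divergence :: "(real ^ 'n \<Rightarrow> real ^ 'n) \<Rightarrow> real ^ 'n \<Rightarrow> real" where
  "divergence F x = (\<Sum>i\<in>UNIV. partial_deriv i (\<lambda>y. F y $ i) x)"

definition matrix_divergence :: "(real ^ 'n \<Rightarrow> real ^ 'n ^ 'n) \<Rightarrow> real ^ 'n \<Rightarrow> real ^ 'n" where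
  "matrix_divergence A x = (\<chi> i. \<Sum>j\<in>UNIV. partial_deriv j (\<lambda>y. A y $ i $ j) x)"

(* The scalar written formally as the pairing of the Hessian operator with A. *)
definition hess_pairing :: "(real ^ 'n \<Rightarrow> real ^ 'n ^ 'n) \<Rightarrow> real ^ 'n \<Rightarrow> real" where
  "hess_pairing A x =
     (\<Sum>i\<in>UNIV. \<Sum>j\<in>UNIV. partial_deriv i (partial_deriv j (\<lambda>y. A y $ i $ j)) x)"

definition weighted_laplacian ::
  "(real ^ 'n \<Rightarrow> real ^ 'n ^ 'n) \<Rightarrow> (real ^ 'n \<Rightarrow> 'b::real_normed_vector) \<Rightarrow> real ^ 'n \<Rightarrow> 'b" where
  "weighted_laplacian A h x =
     (\<Sum>i\<in>UNIV. \<Sum>j\<in>UNIV. partial_deriv i (partial_deriv j (\<lambda>y. (A y $ i $ j) *\<^sub>R h y)) x)"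

definition weighted_norm_sq :: "real ^ 'n ^ 'n \<Rightarrow> real ^ 'n \<Rightarrow> real" where
  "weighted_norm_sq A v = v \<bullet> (A *v v)"

(* The potential at a fixed time: all arguments are functions of the space
   variable only.  On matrices, the inner product of the type real ^ 'n ^ 'n is
   the sum of the products of corresponding entries. *)
definition potential_Re ::
  "real \<Rightarrow> (real ^ 'n \<Rightarrow> real ^ 'n) \<Rightarrow> (real ^ 'n \<Rightarrow> real ^ 'm ^ 'n) \<Rightarrow> (real ^ 'n \<Rightarrow> real ^ 'n ^ 'n)
    \<Rightarrow> (real ^ 'n \<Rightarrow> real) \<Rightarrow> (real ^ 'n \<Rightarrow> real) \<Rightarrow> (real ^ 'n \<Rightarrow> real) \<Rightarrow> real ^ 'n \<Rightarrow> real" where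
  "potential_Re lam f g \<Sigma> q R S x =
     lam\<^sup>2 / 2 * hess_pairing \<Sigma> x
   + lam\<^sup>2 / 2 * (\<Sigma> x \<bullet> hessian R x)
   + gradient S x \<bullet> f x
   + lam\<^sup>2 / 2 * weighted_norm_sq (\<Sigma> x) (gradient R x)
   - 1 / 2 * weighted_norm_sq (\<Sigma> x) (gradient S x)
   + lam\<^sup>2 * (matrix_divergence \<Sigma> x \<bullet> gradient R x)
   + 1 / 2 * (gradient S x \<bullet> ((g x ** transpose (g x)) *v gradient S x))
   + 1 / 2 * (\<Sigma> x \<bullet> hessian S x)
   - q x"

definition potential_Im ::
  "real \<Rightarrow> (real ^ 'n \<Rightarrow> real ^ 'n) \<Rightarrow> (real ^ 'n \<Rightarrow> real ^ 'm ^ 'n) \<Rightarrow> (real ^ 'n \<Rightarrow> real ^ 'n ^ 'n)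
    \<Rightarrow> (real ^ 'n \<Rightarrow> real) \<Rightarrow> (real ^ 'n \<Rightarrow> real) \<Rightarrow> real ^ 'n \<Rightarrow> real" where
  "potential_Im lam f g \<Sigma> R S x =
     lam *
      (1 / 2 * (\<Sigma> x \<bullet> hessian S x)
     + gradient R x \<bullet> (\<Sigma> x *v gradient S x)
     + matrix_divergence \<Sigma> x \<bullet> gradient S x
     - gradient R x \<bullet> (f x + (g x ** transpose (g x)) *v gradient S x)
     - 1 / 2 * divergence (\<lambda>y. f y + (g y ** transpose (g y)) *v gradient S y) x
     + 1 / 2 * weighted_laplacian \<Sigma> R x
     + gradient R x \<bullet> (\<Sigma> x *v gradient R x)
     + (1 / 4 - 1 / 2 * R x) * hess_pairing \<Sigma> x)"

end

theory Submission
  imports Defs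
begin

text \<open>
  The equivalence holds separately at every point \<open>(t, x)\<close>: it is an algebraic identity between
  the residuals of the three equations. Write \<open>\<psi> = exp u\<close> with \<open>u = R + (\<i>/\<lambda>) S\<close>. Since
  \<open>\<Sigma>\<close> is symmetric, the product rule gives
  \<open>\<Delta>\<^sub>\<Sigma> (exp u) = (\<langle>Hess, \<Sigma>\<rangle> + 2 \<langle>\<nabla> \<cdot> \<Sigma>, \<nabla> u\<rangle> + \<langle>\<Sigma>, Hess u\<rangle> + \<nabla> u \<cdot> \<Sigma> \<nabla> u) exp u\<close>,
  and \<open>\<partial>\<^sub>t \<psi> = (\<partial>\<^sub>t R + (\<i>/\<lambda>) \<partial>\<^sub>t S) \<psi>\<close>. So the Schroedinger equation can be divided by
  \<open>\<psi>\<close>, which never vanishes, and split into real and imaginary parts.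

  In the real part, the terms of \<open>\<lambda>\<^sup>2/2 \<Delta>\<^sub>\<Sigma> \<psi> / \<psi>\<close> cancel against those that \<open>Re V\<close> shares
  with them, and what is left is the Hamilton-Jacobi-Bellman equation. In the imaginary part, the
  terms with derivatives of \<open>S\<close> against \<open>\<Sigma>\<close> cancel. Expanding
  \<open>\<Delta>\<^sub>\<Sigma> R = \<langle>Hess, \<Sigma>\<rangle> R + 2 \<langle>\<nabla> \<cdot> \<Sigma>, \<nabla> R\<rangle> + \<langle>\<Sigma>, Hess R\<rangle>\<close> also removes the undifferentiated
  \<open>R\<close> from \<open>Im V\<close>; what remains is the Fokker-Planck equation divided by \<open>2 \<rho>\<close>, because
  \<open>\<rho> = exp (2 R)\<close> makes \<open>\<Delta>\<^sub>\<Sigma> \<rho> / \<rho>\<close> another instance of the formula for exponentials.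
  The boundary conditions agree because \<open>\<psi> \<psi>\<dagger> = exp (2 R) = \<rho>\<close>.

  The formula for exponentials is \<open>weighted_laplacian_exp\<close>, the pointwise algebra is
  \<open>madelung_pointwise\<close>.
\<close>

section \<open>Partial derivatives along the coordinate directions\<close>

text \<open>
  The partial derivatives below are derivatives along coordinate lines, so their calculus only
  needs differentiability along those lines. This property passes through products and
  compositions more easily than \<open>C2_space\<close>, whose derivatives live in a space of operators;
  \<open>C2_space_imp_twice_partially_differentiable\<close> makes the transition once.
\<close>

definition partially_differentiable :: "(real ^ 'n \<Rightarrow> 'b::real_normed_vector) \<Rightarrow> bool" where
  "partially_differentiable h \<longleftrightarrow> (\<forall>i x. (\<lambda>s. h (x + s *\<^sub>R axis i 1)) differentiable at 0)"

definition twice_partially_differentiable :: "(real ^ 'n \<Rightarrow> 'b::real_normed_vector) \<Rightarrow> bool" where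
  "twice_partially_differentiable h \<longleftrightarrow>
     partially_differentiable h \<and> (\<forall>j. partially_differentiable (partial_deriv j h))"

lemma partial_deriv_eqI:
  assumes "((\<lambda>s. h (x + s *\<^sub>R axis i 1)) has_vector_derivative d) (at 0)"
  shows "partial_deriv i h x = d"
  using assms unfolding partial_deriv_def by (rule vector_derivative_at)

lemma partially_differentiableI:
  assumes "\<And>i x. ((\<lambda>s. h (x + s *\<^sub>R axis i 1)) has_vector_derivative d i x) (at 0)"
  shows "partially_differentiable h"
  unfolding partially_differentiable_def using assms differentiableI_vector by blast

lemma has_partial_deriv:
  assumes "partially_differentiable h"
  shows "((\<lambda>s. h (x + s *\<^sub>R axis i 1)) has_vector_derivative partial_deriv i h x) (at 0)"
  using assms unfolding partially_differentiable_def partial_deriv_def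
  by (simp add: vector_derivative_works)

lemma partial_deriv_bounded_linear:
  assumes "bounded_linear L" "partially_differentiable h"
  shows "partial_deriv i (\<lambda>y. L (h y)) = (\<lambda>x. L (partial_deriv i h x))"
    and "partially_differentiable (\<lambda>y. L (h y))"
proof -
  have *: "((\<lambda>s. L (h (x + s *\<^sub>R axis i 1))) has_vector_derivative L (partial_deriv i h x)) (at 0)"
    for i x
    using bounded_linear.has_vector_derivative[OF assms(1) has_partial_deriv[OF assms(2)]] .
  show "partial_deriv i (\<lambda>y. L (h y)) = (\<lambda>x. L (partial_deriv i h x))"
    using * by (intro ext partial_deriv_eqI)
  show "partially_differentiable (\<lambda>y. L (h y))"
    using * by (rule partially_differentiableI)
qed

lemma twice_partially_differentiable_bounded_linear:
  assumes "bounded_linear L" "twice_partially_differentiable h"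
  shows "twice_partially_differentiable (\<lambda>y. L (h y))"
  using assms unfolding twice_partially_differentiable_def
  by (auto simp: partial_deriv_bounded_linear)

lemma partial_deriv_add:
  assumes "partially_differentiable h" "partially_differentiable k"
  shows "partial_deriv i (\<lambda>y. h y + k y) = (\<lambda>x. partial_deriv i h x + partial_deriv i k x)"
    and "partially_differentiable (\<lambda>y. h y + k y)"
proof -
  have *: "((\<lambda>s. h (x + s *\<^sub>R axis i 1) + k (x + s *\<^sub>R axis i 1)) has_vector_derivative
      partial_deriv i h x + partial_deriv i k x) (at 0)" for i x
    using assms by (intro has_vector_derivative_add has_partial_deriv)
  show "partial_deriv i (\<lambda>y. h y + k y) = (\<lambda>x. partial_deriv i h x + partial_deriv i k x)"
    using * by (intro ext partial_deriv_eqI)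
  show "partially_differentiable (\<lambda>y. h y + k y)"
    using * by (rule partially_differentiableI)
qed

lemma partially_differentiable_sum:
  assumes "\<And>k. k \<in> K \<Longrightarrow> partially_differentiable (h k)" "finite K"
  shows "partially_differentiable (\<lambda>y. \<Sum>k\<in>K. h k y)"
  using assms(2,1) unfolding partially_differentiable_def by (auto intro!: differentiable_sum)

lemma partial_deriv_mult:
  fixes h k :: "real ^ 'n \<Rightarrow> 'b::real_normed_algebra"
  assumes "partially_differentiable h" "partially_differentiable k"
  shows "partial_deriv i (\<lambda>y. h y * k y) =
      (\<lambda>x. partial_deriv i h x * k x + h x * partial_deriv i k x)"
    and "partially_differentiable (\<lambda>y. h y * k y)"
proof -
  have *: "((\<lambda>s. h (x + s *\<^sub>R axis i 1) * k (x + s *\<^sub>R axis i 1)) has_vector_derivative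
      partial_deriv i h x * k x + h x * partial_deriv i k x) (at 0)" for i x
    using has_vector_derivative_mult[OF has_partial_deriv[OF assms(1), where i=i and x=x]
        has_partial_deriv[OF assms(2), where i=i and x=x]]
    by (simp add: add.commute)
  show "partial_deriv i (\<lambda>y. h y * k y) =
      (\<lambda>x. partial_deriv i h x * k x + h x * partial_deriv i k x)"
    using * by (intro ext partial_deriv_eqI)
  show "partially_differentiable (\<lambda>y. h y * k y)"
    using * by (rule partially_differentiableI)
qed

lemma partial_deriv_scaleR:
  fixes k :: "real ^ 'n \<Rightarrow> 'b::real_normed_vector"
  assumes "partially_differentiable a" "partially_differentiable k"
  shows "partial_deriv i (\<lambda>y. a y *\<^sub>R k y) =
      (\<lambda>x. partial_deriv i a x *\<^sub>R k x + a x *\<^sub>R partial_deriv i k x)"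
    and "partially_differentiable (\<lambda>y. a y *\<^sub>R k y)"
proof -
  have *: "((\<lambda>s. a (x + s *\<^sub>R axis i 1) *\<^sub>R k (x + s *\<^sub>R axis i 1)) has_vector_derivative
      partial_deriv i a x *\<^sub>R k x + a x *\<^sub>R partial_deriv i k x) (at 0)" for i x
    using has_vector_derivative_scaleR[OF
        has_partial_deriv[OF assms(1), where i=i and x=x,
          folded has_real_derivative_iff_has_vector_derivative]
        has_partial_deriv[OF assms(2), where i=i and x=x]]
    by (simp add: add.commute)
  show "partial_deriv i (\<lambda>y. a y *\<^sub>R k y) =
      (\<lambda>x. partial_deriv i a x *\<^sub>R k x + a x *\<^sub>R partial_deriv i k x)"
    using * by (intro ext partial_deriv_eqI)
  show "partially_differentiable (\<lambda>y. a y *\<^sub>R k y)"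
    using * by (rule partially_differentiableI)
qed

lemma partial_deriv_chain:
  fixes h :: "real ^ 'n \<Rightarrow> 'b::real_normed_field"
  assumes "partially_differentiable h" "\<And>x. (F has_field_derivative F' (h x)) (at (h x))"
  shows "partial_deriv i (\<lambda>y. F (h y)) = (\<lambda>x. partial_deriv i h x * F' (h x))"
    and "partially_differentiable (\<lambda>y. F (h y))"
proof -
  have *: "((\<lambda>s. F (h (x + s *\<^sub>R axis i 1))) has_vector_derivative
      partial_deriv i h x * F' (h x)) (at 0)" for i x
    using field_vector_diff_chain_at[OF has_partial_deriv[OF assms(1), where i=i and x=x],
        where g=F and g'="F' (h x)"] assms(2)
    by (simp add: o_def)
  show "partial_deriv i (\<lambda>y. F (h y)) = (\<lambda>x. partial_deriv i h x * F' (h x))"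
    using * by (intro ext partial_deriv_eqI)
  show "partially_differentiable (\<lambda>y. F (h y))"
    using * by (rule partially_differentiableI)
qed

lemma has_vector_derivative_along_axis:
  assumes "\<And>x. (h has_derivative D x) (at x)"
  shows "((\<lambda>s. h (x + s *\<^sub>R axis i 1)) has_vector_derivative D x (axis i 1)) (at 0)"
proof -
  have line: "((\<lambda>s::real. x + s *\<^sub>R axis i 1) has_derivative (\<lambda>s. s *\<^sub>R axis i 1)) (at 0)"
    by (auto intro!: derivative_eq_intros)
  interpret bounded_linear "D x" using assms by (rule has_derivative_bounded_linear)
  have "(h has_derivative D x) (at (x + 0 *\<^sub>R axis i 1))" using assms by simp
  from diff_chain_at[OF line this] show ?thesis
    by (simp add: has_vector_derivative_def o_def scaleR)
qed

lemma C1_space_imp_partially_differentiable: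
  assumes "C1_space h" shows "partially_differentiable h"
proof -
  obtain D where "\<And>x. (h has_derivative blinfun_apply (D x)) (at x)"
    using assms unfolding C1_space_def by blast
  from has_vector_derivative_along_axis[OF this] show ?thesis
    by (rule partially_differentiableI)
qed

text \<open>
  The partial derivative in direction \<open>j\<close> is the total derivative, evaluated at a fixed basis
  vector; this evaluation is linear and bounded, so differentiability of the total derivative
  carries over.
\<close>

lemma C2_space_imp_twice_partially_differentiable:
  assumes "C2_space h" shows "twice_partially_differentiable h"
proof -
  obtain D where D: "\<And>x. (h has_derivative blinfun_apply (D x)) (at x)" and C1: "C1_space D"
    using assms unfolding C2_space_def by blast
  note vd = has_vector_derivative_along_axis[OF D]
  have "partial_deriv j h = (\<lambda>x. blinfun_apply (D x) (axis j 1))" for j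
    using vd by (intro ext partial_deriv_eqI)
  moreover have "partially_differentiable (\<lambda>x. blinfun_apply (D x) (axis j 1))" for j
    using C1_space_imp_partially_differentiable[OF C1] blinfun.bounded_linear_left
    by (rule partial_deriv_bounded_linear(2)[rotated])
  moreover have "partially_differentiable h" using vd by (rule partially_differentiableI)
  ultimately show ?thesis unfolding twice_partially_differentiable_def by simp
qed

lemma twice_partially_differentiable_entry:
  assumes "twice_partially_differentiable A"
  shows "twice_partially_differentiable (\<lambda>y. A y $ i $ j)"
  by (intro twice_partially_differentiable_bounded_linear[where L="\<lambda>v. v $ j"]
      twice_partially_differentiable_bounded_linear[where L="\<lambda>v. v $ i"]
      bounded_linear_vec_nth assms)

lemma twice_partially_differentiable_half_ln:
  fixes r :: "real ^ 'n \<Rightarrow> real"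
  assumes r: "twice_partially_differentiable r" and pos: "\<And>x. 0 < r x"
  shows "twice_partially_differentiable (\<lambda>y. 1 / 2 * ln (r y))"
proof -
  have r1: "partially_differentiable r" and r2: "partially_differentiable (partial_deriv j r)" for j
    using r unfolding twice_partially_differentiable_def by auto
  have ln: "((\<lambda>z. 1 / 2 * ln z) has_field_derivative inverse (2 * r x)) (at (r x))" for x
    using pos[of x] by (auto intro!: derivative_eq_intros simp: field_simps)
  have inv: "((\<lambda>z. inverse (2 * z)) has_field_derivative - (1 / (2 * (r x)\<^sup>2))) (at (r x))" for x
    using pos[of x] by (auto intro!: derivative_eq_intros simp: field_simps power2_eq_square)
  note c1 = partial_deriv_chain[OF r1, where F="\<lambda>z. 1 / 2 * ln z" and F'="\<lambda>z. inverse (2 * z)", OF ln]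
  note c2 = partial_deriv_chain[OF r1, where F="\<lambda>z. inverse (2 * z)" and F'="\<lambda>z. - (1 / (2 * z\<^sup>2))", OF inv]
  show ?thesis
    unfolding twice_partially_differentiable_def c1(1)
    using c1(2) partial_deriv_mult(2)[OF r2 c2(2)] by blast
qed

section \<open>Weighted Laplacian of products and exponentials\<close>

text \<open>
  The product rule produces the two mixed terms \<open>\<partial>\<^sub>j A\<^sub>i\<^sub>j \<partial>\<^sub>i h\<close> and \<open>\<partial>\<^sub>i A\<^sub>i\<^sub>j \<partial>\<^sub>j h\<close>. Symmetry of
  \<open>A\<close> makes their sums equal, whence the factor 2 before the divergence of \<open>A\<close>.
\<close>

lemma weighted_laplacian_expand:
  fixes h :: "real ^ 'n \<Rightarrow> 'b::real_normed_vector"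
  assumes A: "twice_partially_differentiable A" and sym: "\<And>y i j. A y $ i $ j = A y $ j $ i"
    and h: "twice_partially_differentiable h"
  shows "weighted_laplacian A h x =
      hess_pairing A x *\<^sub>R h x
    + 2 *\<^sub>R (\<Sum>i\<in>UNIV. matrix_divergence A x $ i *\<^sub>R partial_deriv i h x)
    + (\<Sum>i\<in>UNIV. \<Sum>j\<in>UNIV. A x $ i $ j *\<^sub>R partial_deriv i (partial_deriv j h) x)"
proof -
  let ?a = "\<lambda>i j y. A y $ i $ j"
  have a1: "partially_differentiable (?a i j)"
    and a2: "partially_differentiable (partial_deriv k (?a i j))" for i j k
    using twice_partially_differentiable_entry[OF A, of i j]
    unfolding twice_partially_differentiable_def by auto
  have h1: "partially_differentiable h" and h2: "partially_differentiable (partial_deriv k h)" for k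
    using h unfolding twice_partially_differentiable_def by auto
  have second_order: "partial_deriv i (partial_deriv j (\<lambda>y. ?a i j y *\<^sub>R h y)) x =
      partial_deriv i (partial_deriv j (?a i j)) x *\<^sub>R h x
      + partial_deriv j (?a i j) x *\<^sub>R partial_deriv i h x
      + partial_deriv i (?a i j) x *\<^sub>R partial_deriv j h x
      + ?a i j x *\<^sub>R partial_deriv i (partial_deriv j h) x" for i j
    by (simp add: partial_deriv_scaleR partial_deriv_add a1 a2 h1 h2)
  have "(\<Sum>i\<in>UNIV. \<Sum>j\<in>UNIV. partial_deriv i (?a i j) x *\<^sub>R partial_deriv j h x) =
      (\<Sum>j\<in>UNIV. \<Sum>i\<in>UNIV. partial_deriv i (?a j i) x *\<^sub>R partial_deriv j h x)"
    by (subst sum.swap) (simp add: sym)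
  then show ?thesis
    unfolding weighted_laplacian_def second_order
    by (simp add: hess_pairing_def matrix_divergence_def sum.distrib scaleR_sum_left scaleR_2)
qed

lemma inner_hessian: "A \<bullet> hessian h x =
    (\<Sum>i\<in>UNIV. \<Sum>j\<in>UNIV. A $ i $ j * partial_deriv i (partial_deriv j h) x)"
  by (simp add: inner_vec_def hessian_def)

lemma weighted_laplacian_real:
  fixes h :: "real ^ 'n \<Rightarrow> real"
  assumes "twice_partially_differentiable A" "\<And>y i j. A y $ i $ j = A y $ j $ i"
    and "twice_partially_differentiable h"
  shows "weighted_laplacian A h x =
    hess_pairing A x * h x + 2 * (matrix_divergence A x \<bullet> gradient h x) + A x \<bullet> hessian h x"
  unfolding weighted_laplacian_expand[OF assms]
  unfolding inner_hessian by (simp add: inner_vec_def gradient_def)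

lemma twice_partially_differentiable_exp:
  fixes u :: "real ^ 'n \<Rightarrow> 'b::{real_normed_field,banach}"
  assumes u: "twice_partially_differentiable u"
  shows "twice_partially_differentiable (\<lambda>y. exp (u y))"
    and "partial_deriv j (\<lambda>y. exp (u y)) = (\<lambda>x. partial_deriv j u x * exp (u x))"
    and "partial_deriv i (partial_deriv j (\<lambda>y. exp (u y))) =
      (\<lambda>x. (partial_deriv i (partial_deriv j u) x + partial_deriv i u x * partial_deriv j u x)
        * exp (u x))"
proof -
  have u1: "partially_differentiable u" and u2: "partially_differentiable (partial_deriv k u)" for k
    using u unfolding twice_partially_differentiable_def by auto
  note e = partial_deriv_chain[OF u1, of exp exp, OF DERIV_exp]
  show "partial_deriv j (\<lambda>y. exp (u y)) = (\<lambda>x. partial_deriv j u x * exp (u x))" for j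
    by (rule e)
  show "twice_partially_differentiable (\<lambda>y. exp (u y))"
    unfolding twice_partially_differentiable_def e(1) using u2 e(2)
    by (auto intro: partial_deriv_mult)
  show "partial_deriv i (partial_deriv j (\<lambda>y. exp (u y))) =
      (\<lambda>x. (partial_deriv i (partial_deriv j u) x + partial_deriv i u x * partial_deriv j u x)
        * exp (u x))"
    unfolding e(1) by (simp add: partial_deriv_mult u2 e algebra_simps)
qed

lemma inner_matrix_vector:
  "v \<bullet> ((A :: real ^ 'n ^ 'n) *v w) = (\<Sum>i\<in>UNIV. \<Sum>j\<in>UNIV. A $ i $ j * (v $ i * w $ j))"
  by (simp add: inner_vec_def matrix_vector_mult_def sum_distrib_left mult_ac)

text \<open>
  The constant \<open>c\<close> is kept arbitrary, in any real normed field, so that one computation serves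
  both the wave function (\<open>c = \<i>/\<lambda>\<close>) and the density \<open>exp (2 R)\<close> (\<open>c = 1\<close>, \<open>a = b = R\<close>). The
  result is sorted by powers of \<open>c\<close>: the quadratic form at \<open>\<nabla>a + c \<nabla>b\<close> contributes to all three
  groups, with a cross term that is doubled by the symmetry of \<open>A\<close>, and the terms linear in
  \<open>a + c b\<close> contribute to the first two.
\<close>

lemma weighted_laplacian_exp:
  fixes a b :: "real ^ 'n \<Rightarrow> real" and c :: "'b::{real_normed_field,banach}"
  assumes A: "twice_partially_differentiable A" and sym: "\<And>y i j. A y $ i $ j = A y $ j $ i"
    and a: "twice_partially_differentiable a" and b: "twice_partially_differentiable b"
  shows "weighted_laplacian A (\<lambda>y. exp (of_real (a y) + c * of_real (b y))) x =
    (of_real (hess_pairing A x + 2 * (matrix_divergence A x \<bullet> gradient a x) + A x \<bullet> hessian a x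
        + weighted_norm_sq (A x) (gradient a x))
     + c * of_real (2 * (matrix_divergence A x \<bullet> gradient b x) + A x \<bullet> hessian b x
        + 2 * (gradient a x \<bullet> (A x *v gradient b x)))
     + c\<^sup>2 * of_real (weighted_norm_sq (A x) (gradient b x)))
    * exp (of_real (a x) + c * of_real (b x))"
proof -
  let ?u = "\<lambda>y. of_real (a y) + c * of_real (b y) :: 'b"
  have a1: "partially_differentiable a" and a2: "partially_differentiable (partial_deriv k a)"
    and b1: "partially_differentiable b" and b2: "partially_differentiable (partial_deriv k b)" for k
    using a b unfolding twice_partially_differentiable_def by auto
  have lin: "bounded_linear (\<lambda>z. c * of_real z)"
    using bounded_linear_compose[OF bounded_linear_mult_right bounded_linear_of_real] .
  note lin_a = partial_deriv_bounded_linear[where L="of_real :: real \<Rightarrow> 'b", OF bounded_linear_of_real]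
  note lin_b = partial_deriv_bounded_linear[OF lin]
  have comb: "partial_deriv i (\<lambda>y. of_real (h y) + c * of_real (k y) :: 'b) =
      (\<lambda>x. of_real (partial_deriv i h x) + c * of_real (partial_deriv i k x))"
    "partially_differentiable (\<lambda>y. of_real (h y) + c * of_real (k y) :: 'b)"
    if "partially_differentiable h" "partially_differentiable k" for h k i
    using partial_deriv_add[OF lin_a(2) lin_b(2), OF that] lin_a(1)[OF that(1)] lin_b(1)[OF that(2)]
    by simp_all
  have u: "twice_partially_differentiable ?u"
    unfolding twice_partially_differentiable_def using a1 a2 b1 b2 by (simp add: comb)
  have cross: "(\<Sum>i\<in>UNIV. \<Sum>j\<in>UNIV. A x $ i $ j * (gradient b x $ i * gradient a x $ j)) =
     (\<Sum>i\<in>UNIV. \<Sum>j\<in>UNIV. A x $ i $ j * (gradient a x $ i * gradient b x $ j))"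
    by (subst sum.swap) (simp add: sym[of x] mult_ac)
  let ?E = "exp (?u x)"
  have d1: "(\<Sum>i\<in>UNIV. matrix_divergence A x $ i *\<^sub>R partial_deriv i (\<lambda>y. exp (?u y)) x) =
     (of_real (matrix_divergence A x \<bullet> gradient a x)
       + c * of_real (matrix_divergence A x \<bullet> gradient b x)) * ?E"
    by (simp add: twice_partially_differentiable_exp(2)[OF u] comb a1 b1 inner_vec_def gradient_def
        scaleR_conv_of_real sum_distrib_left sum_distrib_right sum.distrib algebra_simps)
  have d2: "(\<Sum>i\<in>UNIV. \<Sum>j\<in>UNIV.
        A x $ i $ j *\<^sub>R partial_deriv i (partial_deriv j (\<lambda>y. exp (?u y))) x) =
     (of_real (A x \<bullet> hessian a x + weighted_norm_sq (A x) (gradient a x))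
       + c * of_real (A x \<bullet> hessian b x
          + (\<Sum>i\<in>UNIV. \<Sum>j\<in>UNIV. A x $ i $ j * (gradient a x $ i * gradient b x $ j))
          + (\<Sum>i\<in>UNIV. \<Sum>j\<in>UNIV. A x $ i $ j * (gradient b x $ i * gradient a x $ j)))
       + c\<^sup>2 * of_real (weighted_norm_sq (A x) (gradient b x))) * ?E"
    unfolding twice_partially_differentiable_exp(3)[OF u]
    by (simp add: comb a1 b1 a2 b2 inner_hessian inner_matrix_vector weighted_norm_sq_def gradient_def
        scaleR_conv_of_real sum_distrib_left sum_distrib_right sum.distrib algebra_simps
        power2_eq_square)
  show ?thesis
    unfolding weighted_laplacian_expand[OF A sym twice_partially_differentiable_exp(1)[OF u]] d1 d2
      cross inner_matrix_vector[of "gradient a x" "A x" "gradient b x"]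
    by (simp add: scaleR_conv_of_real algebra_simps)
qed

lemma divergence_scaleR:
  fixes F :: "real ^ 'n \<Rightarrow> real ^ 'n"
  assumes r: "partially_differentiable r" and F: "partially_differentiable F"
  shows "divergence (\<lambda>y. r y *\<^sub>R F y) x = r x * divergence F x + gradient r x \<bullet> F x"
proof -
  have "partially_differentiable (\<lambda>y. F y $ i)" for i
    using bounded_linear_vec_nth F by (rule partial_deriv_bounded_linear)
  then show ?thesis
    by (simp add: divergence_def gradient_def inner_vec_def partial_deriv_mult r
        sum.distrib sum_distrib_left algebra_simps)
qed

lemma partially_differentiable_vec:
  fixes F :: "real ^ 'n \<Rightarrow> real ^ 'k"
  assumes "\<And>i. partially_differentiable (\<lambda>y. F y $ i)"
  shows "partially_differentiable F"
proof (rule partially_differentiableI)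
  fix j x
  have *: "((\<lambda>s. F (x + s *\<^sub>R axis j 1) $ i) has_vector_derivative
      partial_deriv j (\<lambda>y. F y $ i) x) (at 0)" for i
    by (rule has_partial_deriv[OF assms])
  show "((\<lambda>s. F (x + s *\<^sub>R axis j 1)) has_vector_derivative
      (\<chi> i. partial_deriv j (\<lambda>y. F y $ i) x)) (at 0)"
    using * unfolding has_vector_derivative_def
    by (subst has_derivative_componentwise_within) (auto simp: Basis_vec_def inner_axis)
qed

lemma partially_differentiable_drift:
  fixes f :: "real ^ 'n \<Rightarrow> real ^ 'n" and g :: "real ^ 'n \<Rightarrow> real ^ 'm ^ 'n"
  assumes f: "partially_differentiable f" and g: "partially_differentiable g"
    and S: "twice_partially_differentiable S"
  shows "partially_differentiable (\<lambda>y. f y + (g y ** transpose (g y)) *v gradient S y)"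
proof (rule partially_differentiable_vec)
  fix i
  have f1: "partially_differentiable (\<lambda>y. f y $ i)"
    using bounded_linear_vec_nth f by (rule partial_deriv_bounded_linear)
  have g1: "partially_differentiable (\<lambda>y. g y $ k $ l)" for k l
    using bounded_linear_vec_nth partial_deriv_bounded_linear(2)[OF bounded_linear_vec_nth g]
    by (rule partial_deriv_bounded_linear)
  have S1: "partially_differentiable (partial_deriv k S)" for k
    using S unfolding twice_partially_differentiable_def by auto
  have "partially_differentiable
      (\<lambda>y. f y $ i + (\<Sum>k\<in>UNIV. (\<Sum>l\<in>UNIV. g y $ i $ l * g y $ k $ l) * partial_deriv k S y))"
    by (intro partial_deriv_add partially_differentiable_sum partial_deriv_mult f1 g1 S1 finite)
  then show "partially_differentiable
      (\<lambda>y. (f y + (g y ** transpose (g y)) *v gradient S y) $ i)"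
    by (simp add: matrix_vector_mult_def matrix_matrix_mult_def transpose_def gradient_def)
qed

section \<open>The Madelung transform\<close>

text \<open>
  The algebraic core, at a single time. The numbers \<open>Rt\<close> and \<open>St\<close> stand for the time derivatives
  of \<open>R\<close> and \<open>S\<close> at \<open>x\<close>, which enter the equations only through their values; accordingly
  \<open>(Rt + (\<i>/lam) St) \<psi>\<close> and \<open>2 Rt r\<close> are the time derivatives of the wave function and of the
  density.
\<close>

lemma madelung_pointwise:
  fixes r R S q :: "real ^ 'n \<Rightarrow> real" and f :: "real ^ 'n \<Rightarrow> real ^ 'n"
    and g :: "real ^ 'n \<Rightarrow> real ^ 'm ^ 'n" and A :: "real ^ 'n \<Rightarrow> real ^ 'n ^ 'n"
    and lam Rt St :: real
  defines "F \<equiv> \<lambda>y. f y + (g y ** transpose (g y)) *v gradient S y"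
    and "\<psi> \<equiv> \<lambda>y. exp (of_real (R y) + \<i> / of_real lam * of_real (S y))"
  assumes lam: "lam \<noteq> 0"
    and A: "twice_partially_differentiable A" and sym: "\<And>y i j. A y $ i $ j = A y $ j $ i"
    and R: "twice_partially_differentiable R" and S: "twice_partially_differentiable S"
    and F: "partially_differentiable F"
    and r: "r = (\<lambda>y. exp (2 * R y))"
  shows "\<i> * of_real lam * ((of_real Rt + \<i> / of_real lam * of_real St) * \<psi> x)
       = - of_real (lam\<^sup>2 / 2) * weighted_laplacian A \<psi> x
         + Complex (potential_Re lam f g A q R S x) (potential_Im lam f g A R S x) * \<psi> x
    \<longleftrightarrow>
      2 * Rt * r x + divergence (\<lambda>y. r y *\<^sub>R F y) x = 1 / 2 * weighted_laplacian A r x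
      \<and> St + gradient S x \<bullet> f x
         + 1 / 2 * (gradient S x \<bullet> ((g x ** transpose (g x)) *v gradient S x))
         + 1 / 2 * (A x \<bullet> hessian S x) = q x"
    (is "?schroedinger \<longleftrightarrow> ?fp \<and> ?hjb")
proof -
  have R1: "partially_differentiable R" using R unfolding twice_partially_differentiable_def by simp
  \<comment> \<open>Once the spatial terms are named, the equivalence is elementary algebra in these
     numbers, \<open>Rt\<close>, \<open>St\<close> and \<open>lam\<close>.\<close>
  define hp where "hp = hess_pairing A x"
  define dR where "dR = matrix_divergence A x \<bullet> gradient R x"
  define dS where "dS = matrix_divergence A x \<bullet> gradient S x"
  define HR where "HR = A x \<bullet> hessian R x"
  define HS where "HS = A x \<bullet> hessian S x"
  define RR where "RR = weighted_norm_sq (A x) (gradient R x)"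
  define SS where "SS = weighted_norm_sq (A x) (gradient S x)"
  define RS where "RS = gradient R x \<bullet> (A x *v gradient S x)"
  define fS where "fS = gradient S x \<bullet> f x"
  define gS where "gS = gradient S x \<bullet> ((g x ** transpose (g x)) *v gradient S x)"
  define FR where "FR = gradient R x \<bullet> F x"
  define dF where "dF = divergence F x"
  note coeff_defs = hp_def dR_def dS_def HR_def HS_def RR_def SS_def RS_def fS_def gS_def FR_def dF_def

  have wl_R: "weighted_laplacian A R x = hp * R x + 2 * dR + HR"
    unfolding weighted_laplacian_real[OF A sym R] by (simp add: coeff_defs)
  \<comment> \<open>In this shape the density is an instance of \<open>weighted_laplacian_exp\<close> with \<open>c = 1\<close>.\<close>
  have r': "r = (\<lambda>y. exp (of_real (R y) + 1 * of_real (R y)))" unfolding r by simp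
  have wl_r: "weighted_laplacian A r x = (hp + 4 * dR + 2 * HR + 4 * RR) * r x"
    unfolding r' weighted_laplacian_exp[OF A sym R R]
    by (simp add: coeff_defs weighted_norm_sq_def)
  have exp2: "((\<lambda>z. exp (2 * z)) has_field_derivative 2 * exp (2 * z)) (at z)" for z :: real
    by (auto intro!: derivative_eq_intros)
  note dr = partial_deriv_chain[OF R1, where F="\<lambda>z. exp (2 * z)" and F'="\<lambda>z. 2 * exp (2 * z)", OF exp2]
  have grad_r: "gradient r x = (2 * r x) *\<^sub>R gradient R x"
    unfolding r gradient_def dr(1) by (simp add: vec_eq_iff)
  have div_r: "divergence (\<lambda>y. r y *\<^sub>R F y) x = (dF + 2 * FR) * r x"
    using dr(2) F unfolding r[symmetric]
    by (simp add: divergence_scaleR grad_r coeff_defs algebra_simps)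
  have "r x \<noteq> 0" unfolding r by simp
  have "?fp \<longleftrightarrow> (2 * Rt + dF + 2 * FR) * r x = 1 / 2 * (hp + 4 * dR + 2 * HR + 4 * RR) * r x"
    unfolding wl_r div_r by (simp add: algebra_simps)
  also have "\<dots> \<longleftrightarrow> 2 * Rt + dF + 2 * FR = 1 / 2 * (hp + 4 * dR + 2 * HR + 4 * RR)"
    using \<open>r x \<noteq> 0\<close> by (rule mult_right_cancel)
  finally have fp: "?fp \<longleftrightarrow> Rt = - FR - dF / 2 + (hp + 4 * dR + 2 * HR + 4 * RR) / 4"
    by (auto simp: field_simps)

  have wl_\<psi>: "weighted_laplacian A \<psi> x =
     Complex (hp + 2 * dR + HR + RR - SS / lam\<^sup>2) ((2 * dS + HS + 2 * RS) / lam) * \<psi> x"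
    unfolding \<psi>_def weighted_laplacian_exp[OF A sym R S]
    by (rule arg_cong2[where f="(*)"])
      (auto simp: complex_eq_iff coeff_defs power_divide simp flip: of_real_power)
  have "\<psi> x \<noteq> 0" unfolding \<psi>_def by simp
  define V where "V = Complex (potential_Re lam f g A q R S x) (potential_Im lam f g A R S x)"
  define Z where "Z = Complex (hp + 2 * dR + HR + RR - SS / lam\<^sup>2) ((2 * dS + HS + 2 * RS) / lam)"
  have "?schroedinger \<longleftrightarrow>
     (\<i> * of_real lam * (of_real Rt + \<i> / of_real lam * of_real St)) * \<psi> x
     = (- of_real (lam\<^sup>2 / 2) * Z + V) * \<psi> x"
    unfolding wl_\<psi> V_def[symmetric] Z_def[symmetric] by (simp add: algebra_simps)
  also have "\<dots> \<longleftrightarrow> \<i> * of_real lam * (of_real Rt + \<i> / of_real lam * of_real St)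
     = - of_real (lam\<^sup>2 / 2) * Z + V"
    using \<open>\<psi> x \<noteq> 0\<close> by simp
  also have "\<dots> \<longleftrightarrow> - St = - (lam\<^sup>2 / 2) * Re Z + Re V \<and> lam * Rt = - (lam\<^sup>2 / 2) * Im Z + Im V"
    using lam by (simp add: complex_eq_iff)
  \<comment> \<open>The real part: the terms with factor \<open>lam\<^sup>2\<close> and \<open>SS\<close> cancel.\<close>
  also have "- St = - (lam\<^sup>2 / 2) * Re Z + Re V \<longleftrightarrow> ?hjb"
  proof -
    have "- (lam\<^sup>2 / 2) * Re Z + Re V = fS + gS / 2 + HS / 2 - q x"
      using lam by (simp add: Z_def V_def potential_Re_def flip: coeff_defs) (simp add: field_simps)
    then show ?thesis by (auto simp: coeff_defs)
  qed
  \<comment> \<open>The imaginary part: \<open>dS\<close>, \<open>HS\<close> and \<open>RS\<close> cancel, and so do the two terms with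
     \<open>hp * R x\<close>, one of which comes from \<open>wl_R\<close>.\<close>
  also have "lam * Rt = - (lam\<^sup>2 / 2) * Im Z + Im V \<longleftrightarrow> ?fp"
  proof -
    have "Im V = lam * (HS / 2 + RS + dS - FR - dF / 2 + weighted_laplacian A R x / 2 + RR
        + (1 / 4 - R x / 2) * hp)"
      by (simp add: V_def potential_Im_def coeff_defs F_def weighted_norm_sq_def)
    moreover have "(lam\<^sup>2 / 2) * Im Z = lam * (dS + HS / 2 + RS)"
      using lam by (simp add: Z_def field_simps power2_eq_square)
    ultimately have "- (lam\<^sup>2 / 2) * Im Z + Im V
        = lam * (- FR - dF / 2 + (hp + 4 * dR + 2 * HR + 4 * RR) / 4)"
      unfolding wl_R by (simp add: algebra_simps add_divide_distrib)
    then show ?thesis unfolding fp using lam by simp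
  qed
  finally show ?thesis by blast
qed

theorem theorem1:
  fixes t0 t1 lam :: real
    and \<rho>0 \<rho>1 :: "real ^ 'n \<Rightarrow> real"
    and q :: "real \<Rightarrow> real ^ 'n \<Rightarrow> real"
    and f :: "real \<Rightarrow> real ^ 'n \<Rightarrow> real ^ 'n"
    and g :: "real \<Rightarrow> real ^ 'n \<Rightarrow> real ^ 'm ^ 'n"
    and \<sigma> :: "real \<Rightarrow> real ^ 'n \<Rightarrow> real ^ 'p ^ 'n"
    and \<Sigma> :: "real \<Rightarrow> real ^ 'n \<Rightarrow> real ^ 'n ^ 'n"
    and \<rho> S R :: "real \<Rightarrow> real ^ 'n \<Rightarrow> real"
    and \<psi> \<psi>dag V :: "real \<Rightarrow> real ^ 'n \<Rightarrow> complex"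
  assumes horizon: "t0 < t1"
    and \<rho>0: "prob_density \<rho>0" "finite_second_moment \<rho>0"
    and \<rho>1: "prob_density \<rho>1" "finite_second_moment \<rho>1"
    and q_bounded: "\<exists>B. \<forall>t\<in>{t0..t1}. \<forall>x. \<bar>q t x\<bar> \<le> B"
    and q_measurable: "(\<lambda>(t, x). q t x) \<in> borel_measurable (lebesgue_on ({t0..t1} \<times> UNIV))"
    and \<Sigma>_eq: "\<Sigma> = (\<lambda>t x. \<sigma> t x ** transpose (\<sigma> t x))"
    and A1: "\<exists>c1 c2. 0 < c1 \<and> 0 < c2 \<and> (\<forall>x y. \<forall>t\<in>{t0..t1}.
               norm (f t x) + onorm (\<lambda>v. \<sigma> t x *v v) \<le> c1 * (1 + norm x) \<and>
               norm (f t x - f t y) \<le> c2 * norm (x - y))"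
    and A2: "\<exists>c3>0. \<forall>x. \<forall>t\<in>{t0..t1}. x \<bullet> (\<Sigma> t x *v x) \<ge> c3 * (norm x)\<^sup>2"
    and \<rho>_pos: "\<forall>t\<in>{t0..t1}. \<forall>x. 0 < \<rho> t x"
    and \<rho>_density: "\<forall>t\<in>{t0..t1}. prob_density (\<rho> t)"
    and \<rho>_C1_time: "\<forall>x. C1_on_interval t0 t1 (\<lambda>t. \<rho> t x)"
    and \<rho>_C2_space: "\<forall>t\<in>{t0..t1}. C2_space (\<rho> t)"
    and S_C1_time: "\<forall>x. C1_on_interval t0 t1 (\<lambda>t. S t x)"
    and S_C2_space: "\<forall>t\<in>{t0..t1}. C2_space (S t)"
    and \<Sigma>_C2_space: "\<forall>t\<in>{t0..t1}. C2_space (\<Sigma> t)"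
    and f_C1_space: "\<forall>t\<in>{t0..t1}. C1_space (f t)"
    and g_C1_space: "\<forall>t\<in>{t0..t1}. C1_space (g t)"
    and lam_pos: "0 < lam"
    and R_eq: "R = (\<lambda>t x. 1 / 2 * ln (\<rho> t x))"
    and \<psi>_eq: "\<psi> = (\<lambda>t x. exp (of_real (R t x) + \<i> / of_real lam * of_real (S t x)))"
    and \<psi>dag_eq: "\<psi>dag = (\<lambda>t x. exp (of_real (R t x) - \<i> / of_real lam * of_real (S t x)))"
    and V_eq: "V = (\<lambda>t x. Complex (potential_Re lam (f t) (g t) (\<Sigma> t) (q t) (R t) (S t) x)
                                 (potential_Im lam (f t) (g t) (\<Sigma> t) (R t) (S t) x))"
  shows
    "((\<forall>t\<in>{t0..t1}. \<forall>x.
         vector_derivative (\<lambda>s. \<rho> s x) (at t within {t0..t1})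
         + divergence (\<lambda>y. \<rho> t y *\<^sub>R (f t y + (g t y ** transpose (g t y)) *v gradient (S t) y)) x
         = 1 / 2 * weighted_laplacian (\<Sigma> t) (\<rho> t) x)
      \<and> (\<forall>t\<in>{t0..t1}. \<forall>x.
         vector_derivative (\<lambda>s. S s x) (at t within {t0..t1})
         + gradient (S t) x \<bullet> f t x
         + 1 / 2 * (gradient (S t) x \<bullet> ((g t x ** transpose (g t x)) *v gradient (S t) x))
         + 1 / 2 * (\<Sigma> t x \<bullet> hessian (S t) x)
         = q t x)
      \<and> (\<forall>x. \<rho> t0 x = \<rho>0 x) \<and> (\<forall>x. \<rho> t1 x = \<rho>1 x))
     \<longleftrightarrow>
     ((\<forall>t\<in>{t0..t1}. \<forall>x.
         \<i> * of_real lam * vector_derivative (\<lambda>s. \<psi> s x) (at t within {t0..t1})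
         = - of_real (lam\<^sup>2 / 2) * weighted_laplacian (\<Sigma> t) (\<psi> t) x + V t x * \<psi> t x)
      \<and> (\<forall>x. \<psi> t0 x * \<psi>dag t0 x = of_real (\<rho>0 x))
      \<and> (\<forall>x. \<psi> t1 x * \<psi>dag t1 x = of_real (\<rho>1 x)))"
proof -
  have \<rho>_exp: "\<rho> t x = exp (2 * R t x)" if "t \<in> {t0..t1}" for t x
    using \<rho>_pos that unfolding R_eq by simp
  have pde: "\<i> * of_real lam * vector_derivative (\<lambda>s. \<psi> s x) (at t within {t0..t1})
         = - of_real (lam\<^sup>2 / 2) * weighted_laplacian (\<Sigma> t) (\<psi> t) x + V t x * \<psi> t x
     \<longleftrightarrow>
      vector_derivative (\<lambda>s. \<rho> s x) (at t within {t0..t1})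
         + divergence (\<lambda>y. \<rho> t y *\<^sub>R (f t y + (g t y ** transpose (g t y)) *v gradient (S t) y)) x
         = 1 / 2 * weighted_laplacian (\<Sigma> t) (\<rho> t) x
      \<and> vector_derivative (\<lambda>s. S s x) (at t within {t0..t1})
         + gradient (S t) x \<bullet> f t x
         + 1 / 2 * (gradient (S t) x \<bullet> ((g t x ** transpose (g t x)) *v gradient (S t) x))
         + 1 / 2 * (\<Sigma> t x \<bullet> hessian (S t) x)
         = q t x" if t: "t \<in> {t0..t1}" for t x
  proof -
    let ?T = "at t within {t0..t1}"
    define \<rho>t where "\<rho>t = vector_derivative (\<lambda>s. \<rho> s x) ?T"
    define St where "St = vector_derivative (\<lambda>s. S s x) ?T"
    define Rt where "Rt = \<rho>t / (2 * \<rho> t x)"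
    \<comment> \<open>Derivatives relative to \<open>{t0..t1}\<close> are unique even at the two endpoints, because the
       interval is nondegenerate.\<close>
    have nontrivial: "?T \<noteq> bot"
      using t horizon by (simp add: trivial_limit_within islimpt_Icc)
    have pos: "0 < \<rho> t x" using \<rho>_pos t by blast
    have \<rho>_deriv: "((\<lambda>s. \<rho> s x) has_vector_derivative \<rho>t) ?T"
      and S_deriv: "((\<lambda>s. S s x) has_vector_derivative St) ?T"
      using \<rho>_C1_time S_C1_time t unfolding C1_on_interval_def \<rho>t_def St_def
      by (metis differentiableI_vector vector_derivative_works)+
    have R_deriv: "((\<lambda>s. R s x) has_vector_derivative Rt) ?T"
      using \<rho>_deriv pos unfolding R_eq Rt_def has_real_derivative_iff_has_vector_derivative[symmetric]
      by (auto intro!: derivative_eq_intros simp: field_simps)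
    have "((\<lambda>s. of_real (R s x) + \<i> / of_real lam * of_real (S s x)) has_vector_derivative
        of_real Rt + \<i> / of_real lam * of_real St) ?T"
      by (intro has_vector_derivative_add has_vector_derivative_mult_right
          bounded_linear.has_vector_derivative[OF bounded_linear_of_real] R_deriv S_deriv)
    from field_vector_diff_chain_within[OF this DERIV_subset[OF DERIV_exp subset_UNIV]]
    have "((\<lambda>s. \<psi> s x) has_vector_derivative
        (of_real Rt + \<i> / of_real lam * of_real St) * \<psi> t x) ?T"
      unfolding \<psi>_eq by (simp add: o_def)
    then have \<psi>t: "vector_derivative (\<lambda>s. \<psi> s x) ?T
        = (of_real Rt + \<i> / of_real lam * of_real St) * \<psi> t x"
      using vector_derivative_within[OF nontrivial] by blast
    have \<rho>t: "2 * Rt * \<rho> t x = \<rho>t" using pos by (simp add: Rt_def)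
    have S2: "twice_partially_differentiable (S t)"
      using S_C2_space t by (blast intro: C2_space_imp_twice_partially_differentiable)
    have \<Sigma>2: "twice_partially_differentiable (\<Sigma> t)"
      using \<Sigma>_C2_space t by (blast intro: C2_space_imp_twice_partially_differentiable)
    have R2: "twice_partially_differentiable (R t)"
      unfolding R_eq using \<rho>_C2_space \<rho>_pos t
      by (intro twice_partially_differentiable_half_ln C2_space_imp_twice_partially_differentiable)
        auto
    have drift: "partially_differentiable
        (\<lambda>y. f t y + (g t y ** transpose (g t y)) *v gradient (S t) y)"
      using f_C1_space g_C1_space t
      by (intro partially_differentiable_drift S2 C1_space_imp_partially_differentiable) auto
    have sym: "\<Sigma> t y $ i $ j = \<Sigma> t y $ j $ i" for y i j
      unfolding \<Sigma>_eq by (simp add: matrix_matrix_mult_def transpose_def mult.commute)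
    have "\<rho> t = (\<lambda>y. exp (2 * R t y))" using \<rho>_exp[OF t] by blast
    from madelung_pointwise[OF _ \<Sigma>2 sym R2 S2 drift this, of lam Rt St x "q t"] lam_pos
    show ?thesis
      unfolding \<psi>t \<rho>t \<rho>t_def[symmetric] St_def[symmetric] unfolding \<psi>_eq V_eq by simp
  qed
  have boundary: "\<psi> t x * \<psi>dag t x = of_real z \<longleftrightarrow> \<rho> t x = z" if "t \<in> {t0..t1}" for t x z
  proof -
    have "\<psi> t x * \<psi>dag t x = exp (of_real (2 * R t x))"
      unfolding \<psi>_eq \<psi>dag_eq by (simp flip: exp_add)
    also have "\<dots> = of_real (\<rho> t x)" unfolding \<rho>_exp[OF that] by (rule exp_of_real)
    finally show ?thesis by simp
  qed
  have "t0 \<in> {t0..t1}" "t1 \<in> {t0..t1}" using horizon by auto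
  then show ?thesis using pde boundary by auto
qed

end
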